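(* Let $n\ge 3$, let $A\in\mathcal M_n(\mathbb C)$ and let $\lambda=s+it$ ($s,t\in\mathbb R$) be an eigenvalue of $A$. Let $\delta_1\ge\delta_2\ge\delta_3$ be the three largest eigenvalues of the Hermitian part $H(A)$ (counted with multiplicity), and let $\mathbf u_1,\mathbf u_2$ be orthonormal eigenvectors of $H(A)$ corresponding to $\delta_1$ and $\delta_2$. Define $$\alpha=-i\,\mathbf u_1^*S(A)\mathbf u_1\in\mathbb R,\qquad \beta=-i\,\mathbf u_2^*S(A)\mathbf u_2\in\mathbb R,\qquad \gamma=\mathbf u_2^*S(A)\mathbf u_1\in\mathbb C,$$ $$K_2=\tfrac12\Big[\|S(A)\mathbf u_1\|_2^2+\|S(A)\mathbf u_2\|_2^2-\alpha^2-\beta^2-2|\gamma|^2+\sqrt{\big(\|S(A)\mathbf u_1\|_2^2-\|S(A)\mathbf u_2\|_2^2-\alpha^2+\beta^2\big)^2+4\big|(S(A)\mathbf u_2)^*(S(A)\mathbf u_1)+i\gamma(\alpha+\beta)\big|^2}\ \Big],$$ $$m_1(s,t)=(\delta_1-s)[(\delta_2-s)^2+(\beta-t)^2]+(\delta_2-s)|\gamma|^2,$$ $$m_2(s,t)=i\gamma[(\delta_1-s)(\beta-t)+(\delta_2-s)(\alpha-t)],$$ $$m_3(s,t)=(\delta_2-s)[(\delta_1-s)^2+(\alpha-t)^2]+(\delta_1-s)|\gamma|^2.$$ Then $$\Big[\big((\delta_1-s)(\delta_2-s)-(\alpha-t)(\beta-t)+|\gamma|^2\big)^2+\big((\delta_1-s)(\beta-t)+(\delta_2-s)(\alpha-t)\big)^2\Big](s-\delta_3)$$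 $$\le\ \frac{K_2}{2}\Big[m_1(s,t)+m_3(s,t)+\sqrt{[m_1(s,t)-m_3(s,t)]^2+4|m_2(s,t)|^2}\,\Big].$$
   Context: $\mathcal M_n(\mathbb C)$ is the space of complex $n\times n$ matrices. For $A\in\mathcal M_n(\mathbb C)$, $A^*$ is the conjugate transpose, $H(A)=\frac12(A+A^* )$ is the Hermitian part and $S(A)=\frac12(A-A^* )$ the skew-Hermitian part. $\|\cdot\|_2$ is the Euclidean norm on $\mathbb C^n$. *)

theory Defs
  imports "Jordan_Normal_Form.Schur_Decomposition" "HOL-Analysis.L2_Norm"
begin

text \<open>Throughout, \<open>u\<^sup>* v\<close> is rendered as \<open>v \<bullet>c u\<close>: the library's \<open>\<bullet>c\<close> conjugates its right argument.\<close>

definition hermitian_part :: "complex mat \<Rightarrow> complex mat" where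
  "hermitian_part A = (1/2) \<cdot>\<^sub>m (A + mat_adjoint A)"

definition skew_hermitian_part :: "complex mat \<Rightarrow> complex mat" where
  "skew_hermitian_part A = (1/2) \<cdot>\<^sub>m (A - mat_adjoint A)"

definition vec_norm2 :: "complex vec \<Rightarrow> real" where
  "vec_norm2 v = L2_set (\<lambda>i. cmod (v $ i)) {..<dim_vec v}"

text \<open>The list \<open>ds\<close> contains all eigenvalues of \<open>M\<close>, repeated according to algebraic
  multiplicity, in nonincreasing order. Such a list exists only if all eigenvalues of \<open>M\<close> are
  real, in particular for Hermitian \<open>M\<close>.\<close>

definition decreasing_eigenvalues :: "complex mat \<Rightarrow> real list \<Rightarrow> bool" where
  "decreasing_eigenvalues M ds \<longleftrightarrow>
     sorted_wrt (\<ge>) ds \<and> mset (map complex_of_real ds) = proots (char_poly M)"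

end

theory Submission
  imports Defs
begin

text \<open>Write an eigenvector for the eigenvalue \<open>s + it\<close> as \<open>x = c\<^sub>1 u\<^sub>1 + c\<^sub>2 u\<^sub>2 + w\<close> with \<open>w\<close>
  orthogonal to \<open>u\<^sub>1\<close> and \<open>u\<^sub>2\<close>, and put \<open>d\<^sub>k = \<delta>\<^sub>k - s\<close>. The proof compares three facts about \<open>x\<close>.

  \<^item> The components of \<open>A x = (s + it) x\<close> along \<open>u\<^sub>1\<close> and \<open>u\<^sub>2\<close> form a linear system \<open>B c = y\<close> with
    the matrix \<open>B\<close> whose rows are \<open>(d\<^sub>1 + i(\<alpha> - t), -\<gamma>\<^sup>*)\<close> and \<open>(\<gamma>, d\<^sub>2 + i(\<beta> - t))\<close>, and with the right
    hand side \<open>y\<^sub>k = p\<^sub>k\<^sup>* w\<close>, where \<open>p\<^sub>k\<close> is the part of \<open>S u\<^sub>k\<close> orthogonal to \<open>u\<^sub>1\<close> and \<open>u\<^sub>2\<close>. The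
    bracket on the left of the theorem is \<open>|det B|\<^sup>2\<close>.

  \<^item> The real part of \<open>x\<^sup>* A x\<close> involves only the Hermitian part. By Ky Fan's maximum principle, applied
    to \<open>u\<^sub>1\<close>, \<open>u\<^sub>2\<close> and \<open>w\<close>, the form \<open>w\<^sup>* H w\<close> is at most \<open>\<delta>\<^sub>3 |w|\<^sup>2\<close>, which leaves
    \<open>(s - \<delta>\<^sub>3) |w|\<^sup>2 \<le> d\<^sub>1 |c\<^sub>1|\<^sup>2 + d\<^sub>2 |c\<^sub>2|\<^sup>2\<close>.

  \<^item> \<open>K\<^sub>2\<close> is the largest eigenvalue of the Gram matrix of \<open>p\<^sub>1\<close> and \<open>p\<^sub>2\<close>, so that \<open>|y|\<^sup>2 \<le> K\<^sub>2 |w|\<^sup>2\<close>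
    (lemma \<open>gram_bound\<close>).

  Multiplying the second fact by \<open>|det B|\<^sup>2\<close> and substituting \<open>det B c = adj(B) y\<close> turns its right hand side into
  \<open>y\<^sup>* M y\<close>, where \<open>M = adj(B)\<^sup>* diag(d\<^sub>1, d\<^sub>2) adj(B)\<close> has the diagonal \<open>m\<^sub>1\<close>, \<open>m\<^sub>3\<close> and the off-diagonal
  entry \<open>m\<^sub>2\<close> (lemma \<open>adjugate_form_identity\<close>). With \<open>\<mu>\<close> the largest eigenvalue of \<open>M\<close> this gives
  \<open>|det B|\<^sup>2 (s - \<delta>\<^sub>3) |w|\<^sup>2 \<le> \<mu> |y|\<^sup>2 \<le> \<mu> K\<^sub>2 |w|\<^sup>2\<close>. If \<open>w \<noteq> 0\<close>, division by \<open>|w|\<^sup>2\<close> gives the claim; if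
  \<open>w = 0\<close> then \<open>B c = 0\<close> with \<open>c \<noteq> 0\<close>, so \<open>det B = 0\<close> and the left hand side vanishes. Both steps use \<open>\<mu> \<ge> 0\<close>,
  which follows from \<open>d\<^sub>1 \<ge> 0\<close> (lemma \<open>determinant_gap_inequality\<close>).

  Ky Fan's principle rests on the unitary diagonalization of Hermitian matrices, obtained here from
  a Schur triangularization with a unitary transformation.\<close>

section \<open>Adjoints and the Hermitian inner product\<close>

lemma mat_adjoint_carrier [simp]: "A \<in> carrier_mat m n \<Longrightarrow> mat_adjoint A \<in> carrier_mat n m"
  unfolding mat_adjoint_def by auto

lemma mat_adjoint_dim [simp]:
  "dim_row (mat_adjoint A) = dim_col A" "dim_col (mat_adjoint A) = dim_row A"
  unfolding mat_adjoint_def by auto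

lemma mat_adjoint_index:
  fixes A :: "complex mat"
  assumes "i < dim_col A" "j < dim_row A"
  shows "mat_adjoint A $$ (i, j) = cnj (A $$ (j, i))"
  using assms unfolding mat_adjoint_def by (simp add: mat_of_rows_index)

lemma mat_adjoint_mult:
  fixes A B :: "complex mat"
  assumes "A \<in> carrier_mat l m" "B \<in> carrier_mat m n"
  shows "mat_adjoint (A * B) = mat_adjoint B * mat_adjoint A"
proof (rule eq_matI)
  fix i j assume "i < dim_row (mat_adjoint B * mat_adjoint A)" "j < dim_col (mat_adjoint B * mat_adjoint A)"
  then have "i < n" "j < l" using assms by auto
  then show "mat_adjoint (A * B) $$ (i, j) = (mat_adjoint B * mat_adjoint A) $$ (i, j)"
    using assms by (auto simp: mat_adjoint_index scalar_prod_def mult.commute intro!: sum.cong)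
qed (use assms in auto)

lemma mat_adjoint_adjoint [simp]: "mat_adjoint (mat_adjoint (A :: complex mat)) = A"
  by (rule eq_matI) (auto simp: mat_adjoint_index)

lemma cscalar_sum:
  fixes v w :: "complex vec"
  shows "v \<bullet>c w = (\<Sum>i<dim_vec w. v $ i * cnj (w $ i))"
  unfolding scalar_prod_def by (simp add: lessThan_atLeast0)

lemma cscalar_add_left:
  fixes u v w :: "complex vec"
  assumes "dim_vec u = dim_vec w" "dim_vec v = dim_vec w"
  shows "(u + v) \<bullet>c w = u \<bullet>c w + v \<bullet>c w"
  using assms by (simp add: cscalar_sum algebra_simps sum.distrib)

lemma cscalar_diff_left:
  fixes u v w :: "complex vec"
  assumes "dim_vec u = dim_vec w" "dim_vec v = dim_vec w"
  shows "(u - v) \<bullet>c w = u \<bullet>c w - v \<bullet>c w"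
  using assms by (simp add: cscalar_sum algebra_simps sum_subtractf)

lemma cscalar_smult_left:
  fixes u w :: "complex vec"
  assumes "dim_vec u = dim_vec w"
  shows "(c \<cdot>\<^sub>v u) \<bullet>c w = c * (u \<bullet>c w)"
  using assms by (simp add: cscalar_sum algebra_simps sum_distrib_left)

lemma cscalar_cnj:
  fixes v w :: "complex vec"
  assumes "dim_vec v = dim_vec w"
  shows "cnj (v \<bullet>c w) = w \<bullet>c v"
  using assms by (simp add: cscalar_sum algebra_simps)

lemma cscalar_add_right:
  fixes u v w :: "complex vec"
  assumes "dim_vec u = dim_vec v" "dim_vec w = dim_vec v"
  shows "w \<bullet>c (u + v) = w \<bullet>c u + w \<bullet>c v"
  using assms by (simp add: cscalar_sum algebra_simps sum.distrib)

lemma cscalar_diff_right: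
  fixes u v w :: "complex vec"
  assumes "dim_vec u = dim_vec v" "dim_vec w = dim_vec v"
  shows "w \<bullet>c (u - v) = w \<bullet>c u - w \<bullet>c v"
  using assms by (simp add: cscalar_sum algebra_simps sum_subtractf)

lemma cscalar_smult_right:
  fixes u w :: "complex vec"
  shows "w \<bullet>c (c \<cdot>\<^sub>v u) = cnj c * (w \<bullet>c u)"
  by (simp add: cscalar_sum algebra_simps sum_distrib_left)

lemmas cscalar_sesquilinear =
  cscalar_add_left cscalar_add_right cscalar_diff_left cscalar_diff_right
  cscalar_smult_left cscalar_smult_right

lemma cscalar_self: "v \<bullet>c v = complex_of_real ((vec_norm2 v)\<^sup>2)"
proof -
  have "(vec_norm2 v)\<^sup>2 = (\<Sum>i<dim_vec v. (cmod (v $ i))\<^sup>2)"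
    unfolding vec_norm2_def L2_set_def by (simp add: sum_nonneg)
  then show ?thesis by (simp add: cscalar_sum complex_norm_square del: of_real_power)
qed

lemma vec_norm2_nonneg [simp]: "0 \<le> vec_norm2 v"
  unfolding vec_norm2_def by simp

lemma vec_norm2_eq_0_iff:
  assumes "v \<in> carrier_vec n"
  shows "vec_norm2 v = 0 \<longleftrightarrow> v = 0\<^sub>v n"
  using conjugate_square_eq_0_vec[OF assms] by (simp add: cscalar_self)

lemma cscalar_adjoint:
  fixes A :: "complex mat"
  assumes "A \<in> carrier_mat m n" "v \<in> carrier_vec n" "w \<in> carrier_vec m"
  shows "(A *\<^sub>v v) \<bullet>c w = v \<bullet>c (mat_adjoint A *\<^sub>v w)"
proof -
  have "(A *\<^sub>v v) \<bullet>c w = (\<Sum>i<m. \<Sum>j<n. A $$ (i, j) * v $ j * cnj (w $ i))"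
    using assms by (simp add: cscalar_sum scalar_prod_def lessThan_atLeast0 sum_distrib_right)
  also have "\<dots> = (\<Sum>j<n. \<Sum>i<m. A $$ (i, j) * v $ j * cnj (w $ i))"
    by (rule sum.swap)
  also have "\<dots> = v \<bullet>c (mat_adjoint A *\<^sub>v w)"
    using assms by (simp add: cscalar_sum scalar_prod_def lessThan_atLeast0 sum_distrib_left
        mat_adjoint_index algebra_simps)
  finally show ?thesis .
qed

section \<open>Unitary triangularization and diagonalization\<close>

text \<open>Gram--Schmidt yields pairwise orthogonal vectors starting with \<open>v\<close>; dividing each by its norm
  makes the matrix unitary and keeps its first column on the line of \<open>v\<close>.\<close>

lemma orthonormal_basis_completion:
  fixes v :: "complex vec"
  assumes v: "v \<in> carrier_vec n" and v0: "v \<noteq> 0\<^sub>v n"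
  obtains W c where "W \<in> carrier_mat n n" "mat_adjoint W * W = 1\<^sub>m n" "col W 0 = c \<cdot>\<^sub>v v"
proof -
  interpret cof_vec_space n "TYPE(complex)" .
  have n: "0 < n"
  proof (rule ccontr)
    assume "\<not> 0 < n"
    with v v0 show False by auto
  qed
  define ws where "ws = gram_schmidt n (basis_completion v)"
  note bc = basis_completion[OF v v0]
  have ws: "corthogonal ws" "set ws \<subseteq> carrier_vec n" "length ws = n"
    using gram_schmidt_result[OF bc(2) bc(4) bc(5) ws_def] bc(6) by auto
  have "basis_completion v = v # tl (basis_completion v)"
    using bc(6,7) n by (cases "basis_completion v") auto
  then have "hd ws = v"
    unfolding ws_def using gram_schmidt_hd[OF v] by metis
  then have w0: "ws ! 0 = v"
    using ws(3) n by (cases ws) auto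
  define f where "f i = complex_of_real (1 / vec_norm2 (ws ! i))" for i
  define W where "W = mat n n (\<lambda>(i, j). f j * (ws ! j) $ i)"
  have W: "W \<in> carrier_mat n n" unfolding W_def by simp
  have wsc: "ws ! i \<in> carrier_vec n" if "i < n" for i using ws that by auto
  have colW: "col W j = f j \<cdot>\<^sub>v (ws ! j)" if "j < n" for j
    using that wsc[OF that] by (auto simp: W_def)
  have "mat_adjoint W * W = 1\<^sub>m n"
  proof (rule eq_matI)
    fix i j assume ij: "i < dim_row (1\<^sub>m n :: complex mat)" "j < dim_col (1\<^sub>m n :: complex mat)"
    then have i: "i < n" and j: "j < n" by auto
    have "(mat_adjoint W * W) $$ (i, j) = col W j \<bullet>c col W i"
      using W i j by (auto simp: scalar_prod_def mat_adjoint_index mult.commute)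
    also have "\<dots> = f j * cnj (f i) * (ws ! j \<bullet>c ws ! i)"
      using wsc[OF i] wsc[OF j] i j by (simp add: colW cscalar_sesquilinear)
    also have "\<dots> = (if i = j then 1 else 0)"
    proof (cases "i = j")
      case True
      have "ws ! i \<bullet>c ws ! i \<noteq> 0" using corthogonalD[OF ws(1)] i ws(3) by auto
      then show ?thesis using True by (simp add: f_def cscalar_self power2_eq_square)
    next
      case False
      then show ?thesis using corthogonalD[OF ws(1)] i j ws(3) by auto
    qed
    finally show "(mat_adjoint W * W) $$ (i, j) = 1\<^sub>m n $$ (i, j)" using i j by simp
  qed (use W in auto)
  moreover have "col W 0 = f 0 \<cdot>\<^sub>v v" using colW[OF n] w0 by simp
  ultimately show thesis using that W by blast
qed

text \<open>Deflation: an eigenvector for the first listed eigenvalue, completed to an orthonormal basis,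
  makes the first column of the transformed matrix a multiple of the first unit vector. The remaining
  block has the remaining eigenvalues, so the induction hypothesis applies to it. All basis changes
  are unitary, hence so is their product. The similarity witness \<open>(U, U\<^sup>*)\<close> records that \<open>U\<close> is unitary.\<close>

theorem unitary_schur:
  fixes A :: "complex mat"
  assumes "A \<in> carrier_mat n n" "char_poly A = (\<Prod>e\<leftarrow>es. [:- e, 1:])"
  shows "\<exists>B U. similar_mat_wit A B U (mat_adjoint U) \<and> upper_triangular B \<and> diag_mat B = es"
  using assms
proof (induction es arbitrary: n A)
  case Nil
  then have "n = 0" using degree_monic_char_poly[of A n] by simp
  moreover have "mat_adjoint (1\<^sub>m 0) = (1\<^sub>m 0 :: complex mat)" by (rule eq_matI) auto
  ultimately show ?case using similar_mat_wit_refl[OF Nil(1)] Nil(1)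
    by (intro exI[of _ A] exI[of _ "1\<^sub>m 0"]) (auto simp: diag_mat_def)
next
  case (Cons e es)
  note A = \<open>A \<in> carrier_mat n n\<close>
  have "eigenvalue A e"
    unfolding eigenvalue_root_char_poly[OF A] Cons.prems(2) by simp
  then obtain v where "eigenvector A v e" unfolding eigenvalue_def by blast
  then have v: "v \<in> carrier_vec n" "v \<noteq> 0\<^sub>v n" and Av: "A *\<^sub>v v = e \<cdot>\<^sub>v v"
    using A unfolding eigenvector_def by auto
  obtain W c where W: "W \<in> carrier_mat n n" and WW: "mat_adjoint W * W = 1\<^sub>m n"
    and W0: "col W 0 = c \<cdot>\<^sub>v v"
    using orthonormal_basis_completion[OF v] .
  have Wa: "mat_adjoint W \<in> carrier_mat n n" using W by simp
  have WW': "W * mat_adjoint W = 1\<^sub>m n"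
    using mat_mult_left_right_inverse[OF Wa W WW] .
  obtain k where n: "n = Suc k"
    using eigenvalue_imp_nonzero_dim[OF A \<open>eigenvalue A e\<close>] by (cases n) auto
  define A' where "A' = mat_adjoint W * A * W"
  have A': "A' \<in> carrier_mat n n" unfolding A'_def by (intro mult_carrier_mat[of _ n n] Wa A W)
  have sim: "similar_mat_wit A A' W (mat_adjoint W)"
  proof (rule similar_mat_wit_sym, rule similar_mat_witI[OF WW WW' _ A' A Wa W])
    show "A' = mat_adjoint W * A * W" by (rule A'_def)
  qed
  have col0: "A' $$ (i, 0) = (if i = 0 then e else 0)" if i: "i < n" for i
  proof -
    have "A *\<^sub>v col W 0 = e \<cdot>\<^sub>v col W 0"
      unfolding W0 using A v Av by (simp add: mult_mat_vec smult_smult_assoc mult.commute)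
    moreover have "A' = mat_adjoint W * (A * W)"
      unfolding A'_def by (rule assoc_mult_mat[OF Wa A W])
    moreover have "col (A * W) 0 = A *\<^sub>v col W 0" using A W n by (intro col_mult2) auto
    ultimately have "A' $$ (i, 0) = e * (row (mat_adjoint W) i \<bullet> col W 0)"
      using A W Wa i n by simp
    also have "row (mat_adjoint W) i \<bullet> col W 0 = (mat_adjoint W * W) $$ (i, 0)"
      using W Wa i n by simp
    finally show ?thesis unfolding WW using i n by simp
  qed
  define A2 where "A2 = mat 1 k (\<lambda>(i, j). A' $$ (0, Suc j))"
  define A3 where "A3 = mat k k (\<lambda>(i, j). A' $$ (Suc i, Suc j))"
  define A1 where "A1 = mat 1 1 (\<lambda>_. e)"
  have A1: "A1 \<in> carrier_mat 1 1" and A2: "A2 \<in> carrier_mat 1 k" and A3: "A3 \<in> carrier_mat k k"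
    unfolding A1_def A2_def A3_def by auto
  have block: "A' = four_block_mat A1 A2 (0\<^sub>m k 1) A3"
    by (rule eq_matI) (use A' n col0 in \<open>auto simp: A1_def A2_def A3_def\<close>)
  have "similar_mat A A'" using sim unfolding similar_mat_def by blast
  then have "char_poly A1 * char_poly A3 = char_poly A"
    using char_poly_four_block_zeros_col[OF A1 A2 A3] by (simp add: char_poly_similar block)
  moreover have "char_poly A1 = [:- e, 1:]"
    by (simp add: A1_def char_poly_defs det_def sign_def)
  ultimately have "[:- e, 1:] * char_poly A3 = [:- e, 1:] * (\<Prod>e\<leftarrow>es. [:- e, 1:])"
    using Cons.prems(2) by simp
  then have "char_poly A3 = (\<Prod>e\<leftarrow>es. [:- e, 1:])"
    by (metis mult_cancel_left pCons_eq_0_iff zero_neq_one)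
  from Cons.IH[OF A3 this] obtain B U where
    simB: "similar_mat_wit A3 B U (mat_adjoint U)" and B: "upper_triangular B" "diag_mat B = es"
    by blast
  note U = similar_mat_witD2[OF A3 simB]
  define P where "P = four_block_mat (1\<^sub>m 1) (0\<^sub>m 1 k) (0\<^sub>m k 1) U"
  define C where "C = four_block_mat A1 (A2 * U) (0\<^sub>m k 1) B"
  have P: "P \<in> carrier_mat n n" unfolding P_def n using U four_block_carrier_mat[of "1\<^sub>m 1" 1 1 U k k] by simp
  have Pa: "mat_adjoint P = four_block_mat (1\<^sub>m 1) (0\<^sub>m 1 k) (0\<^sub>m k 1) (mat_adjoint U)"
    by (rule eq_matI) (use U in \<open>auto simp: P_def mat_adjoint_index\<close>)
  have "similar_mat_wit A' C P (mat_adjoint P)"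
    unfolding block C_def Pa unfolding P_def
  proof (rule similar_mat_wit_four_block[OF similar_mat_wit_refl[OF A1] simB _ _ A1 A3])
    show "A2 = 1\<^sub>m 1 * (A2 * U) * mat_adjoint U"
      using assoc_mult_mat[OF A2 U(6) U(7)] A2 U(1,6) by simp
    show "(0\<^sub>m k 1 :: complex mat) = U * 0\<^sub>m k 1 * 1\<^sub>m 1" using U by simp
  qed (use A2 U in auto)
  from similar_mat_wit_trans[OF sim this]
  have "similar_mat_wit A C (W * P) (mat_adjoint (W * P))"
    using mat_adjoint_mult[OF W P] by simp
  moreover have "upper_triangular C"
    unfolding C_def by (intro upper_triangular_four_block[OF A1 U(5) _ B(1)]) (auto simp: A1_def)
  moreover have "diag_mat C = e # es"
    using diag_four_block_mat[OF A1 U(5)] B(2) by (simp add: C_def diag_mat_def A1_def)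
  ultimately show ?case by blast
qed

text \<open>A unitary similarity preserves Hermitian symmetry, and a triangular Hermitian matrix is diagonal.\<close>

lemma hermitian_unitary_diagonalization:
  fixes A :: "complex mat"
  assumes A: "A \<in> carrier_mat n n" and herm: "mat_adjoint A = A"
    and cp: "char_poly A = (\<Prod>e\<leftarrow>es. [:- e, 1:])"
  obtains D U where "similar_mat_wit A D U (mat_adjoint U)" "diagonal_mat D" "diag_mat D = es"
proof -
  obtain B U where sim: "similar_mat_wit A B U (mat_adjoint U)"
    and B: "upper_triangular B" "diag_mat B = es"
    using unitary_schur[OF A cp] by blast
  note wit = similar_mat_witD2[OF A sim]
  note car = wit(5-7)
  have "B = mat_adjoint U * A * U"
    using similar_mat_witD2(3)[OF car(1) similar_mat_wit_sym[OF sim]] .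
  moreover have "mat_adjoint (mat_adjoint U * A * U) = mat_adjoint U * (mat_adjoint (mat_adjoint U * A))"
    by (rule mat_adjoint_mult[OF mult_carrier_mat[OF car(3) A] car(2)])
  moreover have "mat_adjoint (mat_adjoint U * A) = A * U"
    using mat_adjoint_mult[OF car(3) A] herm by simp
  ultimately have "mat_adjoint B = B"
    using A car by simp
  then have "cnj (B $$ (j, i)) = B $$ (i, j)" if "i < n" "j < n" for i j
    using that car mat_adjoint_index[of i B j] by simp
  then have "diagonal_mat B"
    using B(1) car unfolding diagonal_mat_def upper_triangular_def
    by (metis carrier_matD complex_cnj_zero linorder_neqE_nat)
  then show thesis using that sim B(2) by blast
qed

section \<open>Ky Fan's maximum principle\<close>

lemma decreasing_eigenvalues_char_poly:
  assumes "A \<in> carrier_mat n n" "decreasing_eigenvalues A ds"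
  shows "char_poly A = (\<Prod>e\<leftarrow>map complex_of_real ds. [:- e, 1:])" "length ds = n"
proof -
  obtain as where as: "char_poly A = (\<Prod>a\<leftarrow>as. [:- a, 1:])" "length as = n"
    using char_poly_factorized[OF assms(1)] by blast
  have "proots (\<Prod>a\<leftarrow>bs. [:- a, 1:]) = mset bs" for bs :: "complex list"
  proof (induction bs)
    case (Cons b bs)
    have "(\<Prod>a\<leftarrow>bs. [:- a, 1:]) \<noteq> 0" by (auto simp: prod_list_zero_iff)
    then show ?case using Cons.IH by (subst list.map, subst prod_list.Cons, subst proots_mult) auto
  qed simp
  with assms(2) as(1) have eq: "mset (map complex_of_real ds) = mset as"
    unfolding decreasing_eigenvalues_def by simp
  show "length ds = n" using as(2) arg_cong[OF eq, of size] by simp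
  have "mset (map (\<lambda>e. [:- e, 1:]) (map complex_of_real ds)) = mset (map (\<lambda>e. [:- e, 1:]) as)"
    using eq by (metis mset_map)
  then show "char_poly A = (\<Prod>e\<leftarrow>map complex_of_real ds. [:- e, 1:])"
    using as(1) by (metis prod_mset_prod_list)
qed

text \<open>Bessel's inequality for the \<open>i\<close>-th unit vector. Its orthogonal projection \<open>g\<close> onto the span of
  the \<open>y\<^sub>k\<close> satisfies \<open>g\<^sub>i = |g|\<^sup>2 = q\<close>, where \<open>q\<close> is the sum to be bounded, so that \<open>q\<^sup>2 = |g\<^sub>i|\<^sup>2 \<le> |g|\<^sup>2 = q\<close>.\<close>

lemma bessel_coordinate:
  fixes y :: "nat \<Rightarrow> complex vec"
  assumes car: "\<And>k. k < m \<Longrightarrow> y k \<in> carrier_vec n"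
    and orth: "\<And>k l. k < m \<Longrightarrow> l < m \<Longrightarrow> y k \<bullet>c y l = (if k = l then 1 else 0)"
    and i: "i < n"
  shows "(\<Sum>k<m. (cmod (y k $ i))\<^sup>2) \<le> 1"
proof -
  let ?q = "\<Sum>k<m. (cmod (y k $ i))\<^sup>2"
  define g where "g j = (\<Sum>k<m. cnj (y k $ i) * y k $ j)" for j
  have gi: "g i = complex_of_real ?q"
    unfolding g_def by (simp add: complex_norm_square mult.commute del: of_real_power)
  have "complex_of_real (\<Sum>j<n. (cmod (g j))\<^sup>2) = (\<Sum>j<n. g j * cnj (g j))"
    by (simp add: complex_norm_square del: of_real_power)
  also have "\<dots> = (\<Sum>j<n. \<Sum>k<m. \<Sum>l<m. cnj (y k $ i) * y l $ i * (y k $ j * cnj (y l $ j)))"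
    unfolding g_def by (simp add: sum_product algebra_simps)
  also have "\<dots> = (\<Sum>k<m. \<Sum>l<m. \<Sum>j<n. cnj (y k $ i) * y l $ i * (y k $ j * cnj (y l $ j)))"
    by (subst sum.swap, rule sum.cong[OF refl], rule sum.swap)
  also have "\<dots> = (\<Sum>k<m. \<Sum>l<m. cnj (y k $ i) * y l $ i * (y k \<bullet>c y l))"
    using car by (intro sum.cong refl) (auto simp: cscalar_sum sum_distrib_left carrier_vecD[OF car])
  also have "\<dots> = (\<Sum>k<m. \<Sum>l<m. if k = l then cnj (y k $ i) * y l $ i else 0)"
    by (intro sum.cong refl) (auto simp: orth)
  also have "\<dots> = g i" unfolding g_def by (simp)
  finally have "(\<Sum>j<n. (cmod (g j))\<^sup>2) = ?q"
    unfolding gi of_real_eq_iff .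
  moreover have "(cmod (g i))\<^sup>2 \<le> (\<Sum>j<n. (cmod (g j))\<^sup>2)"
    using i by (intro member_le_sum) auto
  ultimately have "?q * ?q \<le> 1 * ?q"
    unfolding gi norm_of_real by (simp add: power2_eq_square)
  moreover have "0 \<le> ?q" by (intro sum_nonneg) auto
  ultimately show ?thesis
    by (cases "?q = 0") (auto simp: mult_le_cancel_right)
qed

text \<open>In the coordinates of an orthonormal eigenbasis the left hand side is \<open>\<Sum>i. \<lambda>\<^sub>i q\<^sub>i\<close> with
  weights \<open>0 \<le> q\<^sub>i \<le> 1\<close> of total \<open>m\<close>. Such a weighted sum is largest when all the weight sits on the
  \<open>m\<close> largest eigenvalues.\<close>

theorem ky_fan_maximum_principle:
  fixes H :: "complex mat" and u :: "nat \<Rightarrow> complex vec"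
  assumes H: "H \<in> carrier_mat n n" "mat_adjoint H = H"
    and ds: "decreasing_eigenvalues H ds"
    and m: "m \<le> n"
    and car: "\<And>k. k < m \<Longrightarrow> u k \<in> carrier_vec n"
    and orth: "\<And>k l. k < m \<Longrightarrow> l < m \<Longrightarrow> u k \<bullet>c u l = (if k = l then 1 else 0)"
  shows "(\<Sum>k<m. Re ((H *\<^sub>v u k) \<bullet>c u k)) \<le> (\<Sum>i<m. ds ! i)"
proof (cases "m = 0")
  case False
  note cp = decreasing_eigenvalues_char_poly[OF H(1) ds]
  obtain D U where sim: "similar_mat_wit H D U (mat_adjoint U)"
    and D: "diagonal_mat D" "diag_mat D = map complex_of_real ds"
    using hermitian_unitary_diagonalization[OF H cp(1)] .
  note wit = similar_mat_witD2[OF H(1) sim]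
  have Dii: "D $$ (i, i) = complex_of_real (ds ! i)" if "i < n" for i
  proof -
    have "D $$ (i, i) = diag_mat D ! i" using that wit(5) by (simp add: diag_mat_def)
    then show ?thesis using D(2) that cp(2) by simp
  qed
  define y where "y k = mat_adjoint U *\<^sub>v u k" for k
  have y: "y k \<in> carrier_vec n" if "k < m" for k
    unfolding y_def using mult_mat_vec_carrier[OF wit(7) car[OF that]] .
  have y_orth: "y k \<bullet>c y l = (if k = l then 1 else 0)" if "k < m" "l < m" for k l
  proof -
    have "y k \<bullet>c y l = u k \<bullet>c (U *\<^sub>v y l)"
      unfolding y_def[of k] using cscalar_adjoint[OF wit(7) car[OF that(1)] y[OF that(2)]] by simp
    also have "U *\<^sub>v y l = u l"
      unfolding y_def using assoc_mult_mat_vec[OF wit(6,7) car[OF that(2)]] wit(1) car[OF that(2)]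
      by simp
    finally show ?thesis using orth that by simp
  qed
  define q where "q i = (\<Sum>k<m. (cmod (y k $ i))\<^sup>2)" for i
  have q0: "0 \<le> q i" for i unfolding q_def by (intro sum_nonneg) auto
  have q1: "q i \<le> 1" if "i < n" for i
    unfolding q_def using bessel_coordinate[OF y y_orth that] .
  have form: "Re ((H *\<^sub>v u k) \<bullet>c u k) = (\<Sum>i<n. ds ! i * (cmod (y k $ i))\<^sup>2)" if k: "k < m" for k
  proof -
    have "(D *\<^sub>v y k) $ i = complex_of_real (ds ! i) * y k $ i" if i: "i < n" for i
    proof -
      have "(D *\<^sub>v y k) $ i = (\<Sum>j<n. D $$ (i, j) * y k $ j)"
        using wit(5) y[OF k] i by (simp add: scalar_prod_def lessThan_atLeast0)
      also have "\<dots> = (\<Sum>j<n. if j = i then D $$ (i, i) * y k $ i else 0)"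
        using D(1) wit(5) i by (intro sum.cong refl) (auto simp: diagonal_mat_def)
      finally show ?thesis using i Dii by simp
    qed
    note Dy = this
    have Dy_carrier: "D *\<^sub>v y k \<in> carrier_vec n"
      by (rule mult_mat_vec_carrier[OF wit(5) y[OF k]])
    have "H *\<^sub>v u k = U * D *\<^sub>v y k"
      unfolding y_def
      using assoc_mult_mat_vec[OF mult_carrier_mat[OF wit(6,5)] wit(7) car[OF k]] wit(3) by simp
    also have "\<dots> = U *\<^sub>v (D *\<^sub>v y k)"
      by (rule assoc_mult_mat_vec[OF wit(6,5) y[OF k]])
    finally have "(H *\<^sub>v u k) \<bullet>c u k = (D *\<^sub>v y k) \<bullet>c y k"
      using cscalar_adjoint[OF wit(6) Dy_carrier car[OF k]] by (simp only: y_def)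
    also have "\<dots> = (\<Sum>i<n. complex_of_real (ds ! i) * (y k $ i * cnj (y k $ i)))"
      using y[OF k] Dy by (simp add: cscalar_sum mult.assoc)
    also have "\<dots> = complex_of_real (\<Sum>i<n. ds ! i * (cmod (y k $ i))\<^sup>2)"
      by (simp add: complex_norm_square del: of_real_power)
    finally show ?thesis by simp
  qed
  have total: "(\<Sum>i<n. q i) = real m"
  proof -
    have "(\<Sum>i<n. (cmod (y k $ i))\<^sup>2) = 1" if "k < m" for k
    proof -
      have "complex_of_real (\<Sum>i<n. (cmod (y k $ i))\<^sup>2) = y k \<bullet>c y k"
        using y[OF that] by (simp add: cscalar_sum complex_norm_square del: of_real_power)
      then show ?thesis using y_orth[OF that that] by (simp only: of_real_eq_1_iff if_True refl)
    qed
    then show ?thesis unfolding q_def by (subst sum.swap) simp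
  qed
  \<comment> \<open>Because the weights add up to \<open>m\<close>, all eigenvalues can be shifted by the \<open>m\<close>-th one, after
    which the first \<open>m\<close> terms are nonnegative and the other ones nonpositive.\<close>
  define e where "e = ds ! (m - 1)"
  have sorted: "ds ! j \<le> ds ! i" if "i \<le> j" "j < n" for i j
    using ds that cp(2) unfolding decreasing_eigenvalues_def
    by (cases "i = j") (auto simp: sorted_wrt_iff_nth_less)
  have "(\<Sum>k<m. Re ((H *\<^sub>v u k) \<bullet>c u k)) = (\<Sum>k<m. \<Sum>i<n. ds ! i * (cmod (y k $ i))\<^sup>2)"
    using form by simp
  also have "\<dots> = (\<Sum>i<n. ds ! i * q i)"
    unfolding q_def sum_distrib_left by (rule sum.swap)
  also have "\<dots> = (\<Sum>i<n. (ds ! i - e) * q i) + e * real m"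
    by (simp add: left_diff_distrib sum_subtractf total flip: sum_distrib_left)
  also have "(\<Sum>i<n. (ds ! i - e) * q i) \<le> (\<Sum>i<n. if i < m then ds ! i - e else 0)"
  proof (intro sum_mono)
    fix i assume "i \<in> {..<n}"
    then have i: "i < n" by simp
    show "(ds ! i - e) * q i \<le> (if i < m then ds ! i - e else 0)"
    proof (cases "i < m")
      case True
      then have "e \<le> ds ! i" unfolding e_def using m False by (intro sorted) auto
      then show ?thesis using True q1[OF i] mult_left_mono[of "q i" 1 "ds ! i - e"] by simp
    next
      case outside: False
      then have "ds ! i \<le> e" unfolding e_def using i by (intro sorted) auto
      then show ?thesis using outside q0[of i] by (simp add: mult_nonpos_nonneg)
    qed
  qed
  also have "(\<Sum>i<n. if i < m then ds ! i - e else 0) = (\<Sum>i<m. ds ! i - e)"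
    using m by (intro sum.mono_neutral_cong_right) auto
  also have "\<dots> + e * real m = (\<Sum>i<m. ds ! i)" by (simp add: sum_subtractf)
  finally show ?thesis by simp
qed simp

text \<open>Ky Fan's principle for \<open>u\<^sub>1\<close>, \<open>u\<^sub>2\<close> and the normalized \<open>w\<close>: the first two already contribute the
  two largest eigenvalues. Arguing with the sum avoids a case distinction on coinciding eigenvalues,
  where \<open>u\<^sub>1\<close> and \<open>u\<^sub>2\<close> need not span the space that belongs to a chosen eigenbasis.\<close>

lemma rayleigh_third_eigenvalue:
  fixes H :: "complex mat"
  assumes H: "H \<in> carrier_mat n n" "mat_adjoint H = H"
    and ds: "decreasing_eigenvalues H ds" and n: "3 \<le> n"
    and u: "u\<^sub>1 \<in> carrier_vec n" "u\<^sub>2 \<in> carrier_vec n" "vec_norm2 u\<^sub>1 = 1" "vec_norm2 u\<^sub>2 = 1" "u\<^sub>2 \<bullet>c u\<^sub>1 = 0"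
    and eig: "H *\<^sub>v u\<^sub>1 = complex_of_real (ds ! 0) \<cdot>\<^sub>v u\<^sub>1" "H *\<^sub>v u\<^sub>2 = complex_of_real (ds ! 1) \<cdot>\<^sub>v u\<^sub>2"
    and w: "w \<in> carrier_vec n" "w \<bullet>c u\<^sub>1 = 0" "w \<bullet>c u\<^sub>2 = 0"
  shows "Re ((H *\<^sub>v w) \<bullet>c w) \<le> ds ! 2 * (vec_norm2 w)\<^sup>2"
proof (cases "vec_norm2 w = 0")
  case True
  then have "w = 0\<^sub>v n" using vec_norm2_eq_0_iff[OF w(1)] by simp
  then show ?thesis using True H by simp
next
  case False
  define r where "r = complex_of_real (1 / vec_norm2 w)"
  define v where "v = r \<cdot>\<^sub>v w"
  have v: "v \<in> carrier_vec n" unfolding v_def using w by simp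
  have "v \<bullet>c v = r * cnj r * (w \<bullet>c w)"
    unfolding v_def by (simp add: cscalar_sesquilinear)
  then have vv: "v \<bullet>c v = 1"
    using False by (simp add: r_def cscalar_self[of w] power2_eq_square)
  have flip: "cnj (u\<^sub>2 \<bullet>c u\<^sub>1) = u\<^sub>1 \<bullet>c u\<^sub>2" "cnj (v \<bullet>c u\<^sub>1) = u\<^sub>1 \<bullet>c v" "cnj (v \<bullet>c u\<^sub>2) = u\<^sub>2 \<bullet>c v"
    by (simp_all only: cscalar_cnj carrier_vecD[OF u(1)] carrier_vecD[OF u(2)] carrier_vecD[OF v])
  have vu: "v \<bullet>c u\<^sub>1 = 0" "v \<bullet>c u\<^sub>2 = 0"
    using w u by (auto simp: v_def cscalar_sesquilinear)
  define f where "f k = (if k = 0 then u\<^sub>1 else if k = 1 then u\<^sub>2 else v)" for k :: nat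
  have "(\<Sum>k<3. Re ((H *\<^sub>v f k) \<bullet>c f k)) \<le> (\<Sum>i<3. ds ! i)"
  proof (rule ky_fan_maximum_principle[OF H ds n])
    show "f k \<bullet>c f l = (if k = l then 1 else 0)" if "k < 3" "l < 3" for k l
      using that vv vu flip u unfolding f_def by (auto simp: cscalar_self)
  qed (use u v in \<open>auto simp: f_def\<close>)
  then have "Re ((H *\<^sub>v u\<^sub>1) \<bullet>c u\<^sub>1) + Re ((H *\<^sub>v u\<^sub>2) \<bullet>c u\<^sub>2) + Re ((H *\<^sub>v v) \<bullet>c v) \<le> ds ! 0 + ds ! 1 + ds ! 2"
    by (simp add: f_def eval_nat_numeral)
  then have "Re ((H *\<^sub>v v) \<bullet>c v) \<le> ds ! 2"
    using u by (simp add: eig cscalar_sesquilinear cscalar_self)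
  moreover have "Re ((H *\<^sub>v v) \<bullet>c v) = Re ((H *\<^sub>v w) \<bullet>c w) / (vec_norm2 w)\<^sup>2"
    using H w by (simp add: v_def r_def mult_mat_vec cscalar_sesquilinear power2_eq_square)
  ultimately show ?thesis using False by (simp add: divide_le_eq)
qed

section \<open>Hermitian forms in two variables\<close>

text \<open>The largest eigenvalue of the Hermitian matrix with diagonal \<open>a\<close>, \<open>d\<close> and off-diagonal entries
  \<open>b\<close> and its conjugate. The right hand side of the
  theorem is the product of two such numbers, \<open>K\<^sub>2\<close> and the one for \<open>m\<^sub>1\<close>, \<open>m\<^sub>3\<close>, \<open>m\<^sub>2\<close>.\<close>

definition herm2_max :: "real \<Rightarrow> real \<Rightarrow> complex \<Rightarrow> real" where
  "herm2_max a d b = (a + d + sqrt ((a - d)\<^sup>2 + 4 * (cmod b)\<^sup>2)) / 2"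

text \<open>With \<open>\<mu>\<close> the largest eigenvalue, \<open>p = \<mu> - a\<close> and \<open>q = \<mu> - d\<close> are nonnegative and the characteristic
  equation reads \<open>p q = |b|\<^sup>2\<close>. Completing the square with \<open>\<surd>p\<close> and \<open>\<surd>q\<close> then gives the bound.\<close>

lemma herm2_form_le:
  "a * (cmod x)\<^sup>2 + d * (cmod y)\<^sup>2 + 2 * Re (b * x * cnj y)
    \<le> herm2_max a d b * ((cmod x)\<^sup>2 + (cmod y)\<^sup>2)"
proof -
  define r where "r = sqrt ((a - d)\<^sup>2 + 4 * (cmod b)\<^sup>2)"
  define p where "p = herm2_max a d b - a"
  define q where "q = herm2_max a d b - d"
  have r: "r\<^sup>2 = (a - d)\<^sup>2 + 4 * (cmod b)\<^sup>2" unfolding r_def by simp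
  have "\<bar>a - d\<bar> \<le> r" unfolding r_def by (rule real_le_rsqrt) simp
  then have pq: "0 \<le> p" "0 \<le> q" unfolding p_def q_def herm2_max_def r_def[symmetric] by auto
  have "p * q = (r\<^sup>2 - (a - d)\<^sup>2) / 4"
    unfolding p_def q_def herm2_max_def r_def[symmetric] by (simp add: power2_eq_square field_simps)
  then have "sqrt p * sqrt q = cmod b"
    using r by (simp flip: real_sqrt_mult)
  then have "p * (cmod x)\<^sup>2 + q * (cmod y)\<^sup>2 - 2 * (cmod b * cmod x * cmod y)
      = (sqrt p * cmod x - sqrt q * cmod y)\<^sup>2"
    using pq by (simp add: power2_diff power_mult_distrib)
  then have "2 * (cmod b * cmod x * cmod y) \<le> p * (cmod x)\<^sup>2 + q * (cmod y)\<^sup>2"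
    by (metis diff_ge_0_iff_ge zero_le_power2)
  moreover have "Re (b * x * cnj y) \<le> cmod b * cmod x * cmod y"
    using complex_Re_le_cmod[of "b * x * cnj y"] by (simp add: norm_mult)
  ultimately show ?thesis unfolding p_def q_def by (simp add: algebra_simps)
qed

text \<open>The second alternative says that the determinant is nonpositive, so the matrix is not definite.\<close>

lemma herm2_max_nonneg:
  assumes "(0 \<le> a \<and> 0 \<le> d) \<or> a * d \<le> (cmod b)\<^sup>2"
  shows "0 \<le> herm2_max a d b"
proof (cases "0 \<le> a + d")
  case True
  then show ?thesis unfolding herm2_max_def by simp
next
  case False
  then have "a * d \<le> (cmod b)\<^sup>2" using assms by auto
  then have "(a + d)\<^sup>2 \<le> (a - d)\<^sup>2 + 4 * (cmod b)\<^sup>2" by (simp add: power2_eq_square algebra_simps)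
  then have "\<bar>a + d\<bar> \<le> sqrt ((a - d)\<^sup>2 + 4 * (cmod b)\<^sup>2)" by (intro real_le_rsqrt) simp
  then show ?thesis unfolding herm2_max_def by simp
qed

text \<open>The norm of \<open>w \<mapsto> (p\<^sup>* w, q\<^sup>* w)\<close> is that of its adjoint, which is governed by the Gram matrix.
  Concretely, let \<open>z = (p\<^sup>* w) p + (q\<^sup>* w) q\<close> and let \<open>Y\<close> be the left hand side. Then \<open>z\<^sup>* w = Y\<close> and
  \<open>|z|\<^sup>2 \<le> K Y\<close>, and \<open>Y \<le> K |w|\<^sup>2\<close> follows from \<open>|K w - z|\<^sup>2 \<ge> 0\<close>.\<close>

lemma gram_bound:
  fixes p q w :: "complex vec"
  assumes "p \<in> carrier_vec n" "q \<in> carrier_vec n" "w \<in> carrier_vec n"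
  shows "(cmod (w \<bullet>c p))\<^sup>2 + (cmod (w \<bullet>c q))\<^sup>2
    \<le> herm2_max ((vec_norm2 p)\<^sup>2) ((vec_norm2 q)\<^sup>2) (p \<bullet>c q) * (vec_norm2 w)\<^sup>2"
proof -
  define x y where "x = w \<bullet>c p" and "y = w \<bullet>c q"
  define K where "K = herm2_max ((vec_norm2 p)\<^sup>2) ((vec_norm2 q)\<^sup>2) (p \<bullet>c q)"
  define Y where "Y = (cmod x)\<^sup>2 + (cmod y)\<^sup>2"
  define z where "z = x \<cdot>\<^sub>v p + y \<cdot>\<^sub>v q"
  have z: "z \<in> carrier_vec n" unfolding z_def using assms by simp
  have cnjs: "cnj (p \<bullet>c q) = q \<bullet>c p" "cnj x = p \<bullet>c w" "cnj y = q \<bullet>c w"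
    using assms by (auto simp: x_def y_def intro!: cscalar_cnj)
  have K: "0 \<le> K" unfolding K_def by (rule herm2_max_nonneg) auto
  have "z \<bullet>c z = (x * cnj x) * (p \<bullet>c p) + (y * cnj y) * (q \<bullet>c q)
      + (p \<bullet>c q * x * cnj y + cnj (p \<bullet>c q * x * cnj y))"
    using assms by (simp add: z_def cscalar_sesquilinear cnjs(1) algebra_simps)
  then have "z \<bullet>c z = complex_of_real ((vec_norm2 p)\<^sup>2 * (cmod x)\<^sup>2 + (vec_norm2 q)\<^sup>2 * (cmod y)\<^sup>2
      + 2 * Re (p \<bullet>c q * x * cnj y))"
    by (simp only: cscalar_self complex_add_cnj) (simp add: complex_norm_square mult.commute  del: of_real_power)
  then have "(vec_norm2 z)\<^sup>2 = (vec_norm2 p)\<^sup>2 * (cmod x)\<^sup>2 + (vec_norm2 q)\<^sup>2 * (cmod y)\<^sup>2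
      + 2 * Re (p \<bullet>c q * x * cnj y)"
    unfolding cscalar_self of_real_eq_iff .
  also have "\<dots> \<le> K * Y" unfolding K_def Y_def by (rule herm2_form_le)
  finally have zK: "(vec_norm2 z)\<^sup>2 \<le> K * Y" .
  have wz: "w \<bullet>c z = complex_of_real Y"
    using assms by (simp add: z_def cscalar_sesquilinear Y_def complex_norm_square x_def y_def mult.commute del: of_real_power)
  then have zw: "z \<bullet>c w = complex_of_real Y"
    using cscalar_cnj[of w z] assms z by simp
  have expand: "(vec_norm2 (complex_of_real c \<cdot>\<^sub>v w - z))\<^sup>2 = c\<^sup>2 * (vec_norm2 w)\<^sup>2 - 2 * c * Y + (vec_norm2 z)\<^sup>2" for c
  proof -
    have "(complex_of_real c \<cdot>\<^sub>v w - z) \<bullet>c (complex_of_real c \<cdot>\<^sub>v w - z)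
      = complex_of_real c * complex_of_real c * (w \<bullet>c w) - complex_of_real c * (w \<bullet>c z)
        - complex_of_real c * (z \<bullet>c w) + z \<bullet>c z"
      using assms z by (simp add: cscalar_sesquilinear algebra_simps)
    also have "\<dots> = complex_of_real (c\<^sup>2 * (vec_norm2 w)\<^sup>2 - 2 * c * Y + (vec_norm2 z)\<^sup>2)"
      by (simp add: wz zw cscalar_self[of w] cscalar_self[of z] power2_eq_square algebra_simps)
    finally show ?thesis unfolding cscalar_self of_real_eq_iff .
  qed
  have "Y \<le> K * (vec_norm2 w)\<^sup>2"
  proof (cases "K = 0")
    case True
    then have "z = 0\<^sub>v n" using zK vec_norm2_eq_0_iff[OF z] by simp
    then have "Y = 0" using zw assms by simp
    then show ?thesis using True by simp
  next
    case False
    have "0 \<le> K\<^sup>2 * (vec_norm2 w)\<^sup>2 - 2 * K * Y + (vec_norm2 z)\<^sup>2"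
      unfolding expand[symmetric] by simp
    then have "K * Y \<le> K * (K * (vec_norm2 w)\<^sup>2)" using zK by (simp add: power2_eq_square algebra_simps)
    then show ?thesis using False K by (simp add: mult_le_cancel_left)
  qed
  then show ?thesis unfolding Y_def K_def x_def y_def .
qed

section \<open>The two-dimensional compression\<close>

text \<open>The next lemmas concern the matrix \<open>B\<close> with rows \<open>(d\<^sub>1 + i x\<^sub>1, -g\<^sup>*)\<close> and \<open>(g, d\<^sub>2 + i x\<^sub>2)\<close>, its
  determinant, and the Hermitian matrix \<open>M = adj(B)\<^sup>* diag(d\<^sub>1, d\<^sub>2) adj(B)\<close>.\<close>

lemma adjugate_solution:
  fixes a\<^sub>1 a\<^sub>2 c\<^sub>1 c\<^sub>2 y\<^sub>1 y\<^sub>2 g :: complex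
  assumes "y\<^sub>1 = a\<^sub>1 * c\<^sub>1 - cnj g * c\<^sub>2" "y\<^sub>2 = g * c\<^sub>1 + a\<^sub>2 * c\<^sub>2"
  shows "(a\<^sub>1 * a\<^sub>2 + g * cnj g) * c\<^sub>1 = a\<^sub>2 * y\<^sub>1 + cnj g * y\<^sub>2"
    and "(a\<^sub>1 * a\<^sub>2 + g * cnj g) * c\<^sub>2 = a\<^sub>1 * y\<^sub>2 - g * y\<^sub>1"
  unfolding assms by (simp_all add: algebra_simps)

lemma cmod_det_squared:
  "(cmod (Complex d\<^sub>1 x\<^sub>1 * Complex d\<^sub>2 x\<^sub>2 + g * cnj g))\<^sup>2
    = (d\<^sub>1 * d\<^sub>2 - x\<^sub>1 * x\<^sub>2 + (cmod g)\<^sup>2)\<^sup>2 + (d\<^sub>1 * x\<^sub>2 + d\<^sub>2 * x\<^sub>1)\<^sup>2"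
  by (simp add: cmod_power2 power2_eq_square[of "Re g"] power2_eq_square[of "Im g"] mult.commute)

text \<open>By Cramer's rule \<open>det B c = adj(B) y\<close>, so \<open>|det B|\<^sup>2\<close> times the form of \<open>diag(d\<^sub>1, d\<^sub>2)\<close> at \<open>c\<close>
  is the form of \<open>M\<close> at \<open>y\<close>. Working with the adjugate instead of the inverse covers singular \<open>B\<close>.\<close>

lemma adjugate_form_identity:
  fixes c\<^sub>1 c\<^sub>2 y\<^sub>1 y\<^sub>2 g :: complex and d\<^sub>1 d\<^sub>2 x\<^sub>1 x\<^sub>2 :: real
  assumes y: "y\<^sub>1 = Complex d\<^sub>1 x\<^sub>1 * c\<^sub>1 - cnj g * c\<^sub>2" "y\<^sub>2 = g * c\<^sub>1 + Complex d\<^sub>2 x\<^sub>2 * c\<^sub>2"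
  shows "((d\<^sub>1 * d\<^sub>2 - x\<^sub>1 * x\<^sub>2 + (cmod g)\<^sup>2)\<^sup>2 + (d\<^sub>1 * x\<^sub>2 + d\<^sub>2 * x\<^sub>1)\<^sup>2) * (d\<^sub>1 * (cmod c\<^sub>1)\<^sup>2 + d\<^sub>2 * (cmod c\<^sub>2)\<^sup>2)
    = (d\<^sub>1 * (d\<^sub>2\<^sup>2 + x\<^sub>2\<^sup>2) + d\<^sub>2 * (cmod g)\<^sup>2) * (cmod y\<^sub>1)\<^sup>2
    + (d\<^sub>2 * (d\<^sub>1\<^sup>2 + x\<^sub>1\<^sup>2) + d\<^sub>1 * (cmod g)\<^sup>2) * (cmod y\<^sub>2)\<^sup>2
    + 2 * Re (\<i> * g * complex_of_real (d\<^sub>1 * x\<^sub>2 + d\<^sub>2 * x\<^sub>1) * y\<^sub>1 * cnj y\<^sub>2)"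
proof -
  define D where "D = Complex d\<^sub>1 x\<^sub>1 * Complex d\<^sub>2 x\<^sub>2 + g * cnj g"
  note c = adjugate_solution[OF y, folded D_def]
  have "(cmod D)\<^sup>2 * (d\<^sub>1 * (cmod c\<^sub>1)\<^sup>2 + d\<^sub>2 * (cmod c\<^sub>2)\<^sup>2) = d\<^sub>1 * (cmod (D * c\<^sub>1))\<^sup>2 + d\<^sub>2 * (cmod (D * c\<^sub>2))\<^sup>2"
    by (simp add: norm_mult power_mult_distrib algebra_simps)
  also have "\<dots> = (d\<^sub>1 * (d\<^sub>2\<^sup>2 + x\<^sub>2\<^sup>2) + d\<^sub>2 * (cmod g)\<^sup>2) * (cmod y\<^sub>1)\<^sup>2
    + (d\<^sub>2 * (d\<^sub>1\<^sup>2 + x\<^sub>1\<^sup>2) + d\<^sub>1 * (cmod g)\<^sup>2) * (cmod y\<^sub>2)\<^sup>2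
    + 2 * Re (\<i> * g * complex_of_real (d\<^sub>1 * x\<^sub>2 + d\<^sub>2 * x\<^sub>1) * y\<^sub>1 * cnj y\<^sub>2)"
    unfolding c cmod_power2 by (simp add: power2_eq_square algebra_simps)
  finally show ?thesis unfolding D_def cmod_det_squared .
qed

text \<open>This is \<open>det M = |det adj(B)|\<^sup>2 d\<^sub>1 d\<^sub>2\<close>, with \<open>det adj(B) = det B\<close> and \<open>G = |g|\<^sup>2\<close>. It transfers the sign of
  \<open>d\<^sub>1 d\<^sub>2\<close> to the determinant of \<open>M\<close>.\<close>

lemma adjugate_form_det:
  fixes d\<^sub>1 d\<^sub>2 x\<^sub>1 x\<^sub>2 G :: real
  shows "(d\<^sub>1 * (d\<^sub>2\<^sup>2 + x\<^sub>2\<^sup>2) + d\<^sub>2 * G) * (d\<^sub>2 * (d\<^sub>1\<^sup>2 + x\<^sub>1\<^sup>2) + d\<^sub>1 * G)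
      - G * (d\<^sub>1 * x\<^sub>2 + d\<^sub>2 * x\<^sub>1)\<^sup>2
    = d\<^sub>1 * d\<^sub>2 * ((d\<^sub>1 * d\<^sub>2 - x\<^sub>1 * x\<^sub>2 + G)\<^sup>2 + (d\<^sub>1 * x\<^sub>2 + d\<^sub>2 * x\<^sub>1)\<^sup>2)"
proof -
  define a b P Q where "a = d\<^sub>2\<^sup>2 + x\<^sub>2\<^sup>2" and "b = d\<^sub>1\<^sup>2 + x\<^sub>1\<^sup>2"
    and "P = d\<^sub>1 * d\<^sub>2 - x\<^sub>1 * x\<^sub>2" and "Q = d\<^sub>1 * x\<^sub>2 + d\<^sub>2 * x\<^sub>1"
  have "(d\<^sub>1 * a + d\<^sub>2 * G) * (d\<^sub>2 * b + d\<^sub>1 * G) - G * Q\<^sup>2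
      = d\<^sub>1 * d\<^sub>2 * (a * b) + G * (d\<^sub>1\<^sup>2 * a + d\<^sub>2\<^sup>2 * b - Q\<^sup>2) + d\<^sub>1 * d\<^sub>2 * G\<^sup>2"
    by (simp add: power2_eq_square algebra_simps)
  also have "a * b = P\<^sup>2 + Q\<^sup>2"
    unfolding a_def b_def P_def Q_def by (simp add: power2_eq_square algebra_simps)
  also have "d\<^sub>1\<^sup>2 * a + d\<^sub>2\<^sup>2 * b - Q\<^sup>2 = 2 * d\<^sub>1 * d\<^sub>2 * P"
    unfolding a_def b_def P_def Q_def by (simp add: power2_eq_square algebra_simps)
  also have "d\<^sub>1 * d\<^sub>2 * (P\<^sup>2 + Q\<^sup>2) + G * (2 * d\<^sub>1 * d\<^sub>2 * P) + d\<^sub>1 * d\<^sub>2 * G\<^sup>2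
      = d\<^sub>1 * d\<^sub>2 * ((P + G)\<^sup>2 + Q\<^sup>2)"
    by (simp add: power2_eq_square algebra_simps)
  finally show ?thesis unfolding a_def b_def P_def Q_def .
qed

text \<open>The theorem after projection to two dimensions: \<open>W\<close> stands for \<open>|w|\<^sup>2\<close>, \<open>d\<^sub>k\<close> for \<open>\<delta>\<^sub>k - s\<close>, and
  \<open>x\<^sub>1\<close>, \<open>x\<^sub>2\<close> for \<open>\<alpha> - t\<close>, \<open>\<beta> - t\<close>. The energy inequality excludes \<open>d\<^sub>1 < 0\<close>, since all its coefficients would
  then have the wrong sign. Consequently \<open>M\<close> is not negative definite: it is positive semidefinite if
  \<open>d\<^sub>2 \<ge> 0\<close>, and has a nonpositive determinant if \<open>d\<^sub>2 < 0 \<le> d\<^sub>1\<close>.\<close>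

lemma determinant_gap_inequality:
  fixes c\<^sub>1 c\<^sub>2 y\<^sub>1 y\<^sub>2 g :: complex and d\<^sub>1 d\<^sub>2 d\<^sub>3 x\<^sub>1 x\<^sub>2 K W :: real
  assumes y: "y\<^sub>1 = Complex d\<^sub>1 x\<^sub>1 * c\<^sub>1 - cnj g * c\<^sub>2" "y\<^sub>2 = g * c\<^sub>1 + Complex d\<^sub>2 x\<^sub>2 * c\<^sub>2"
    and energy: "- d\<^sub>3 * W \<le> d\<^sub>1 * (cmod c\<^sub>1)\<^sup>2 + d\<^sub>2 * (cmod c\<^sub>2)\<^sup>2"
    and coupling: "(cmod y\<^sub>1)\<^sup>2 + (cmod y\<^sub>2)\<^sup>2 \<le> K * W"
    and ord: "d\<^sub>3 \<le> d\<^sub>2" "d\<^sub>2 \<le> d\<^sub>1" and K: "0 \<le> K" and W: "0 \<le> W"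
    and nz: "c\<^sub>1 \<noteq> 0 \<or> c\<^sub>2 \<noteq> 0 \<or> 0 < W"
  shows "((d\<^sub>1 * d\<^sub>2 - x\<^sub>1 * x\<^sub>2 + (cmod g)\<^sup>2)\<^sup>2 + (d\<^sub>1 * x\<^sub>2 + d\<^sub>2 * x\<^sub>1)\<^sup>2) * (- d\<^sub>3)
    \<le> K * herm2_max (d\<^sub>1 * (d\<^sub>2\<^sup>2 + x\<^sub>2\<^sup>2) + d\<^sub>2 * (cmod g)\<^sup>2) (d\<^sub>2 * (d\<^sub>1\<^sup>2 + x\<^sub>1\<^sup>2) + d\<^sub>1 * (cmod g)\<^sup>2)
        (\<i> * g * complex_of_real (d\<^sub>1 * x\<^sub>2 + d\<^sub>2 * x\<^sub>1))"
    (is "?N * _ \<le> K * herm2_max ?m1 ?m3 ?m2")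
proof -
  define \<mu> where "\<mu> = herm2_max ?m1 ?m3 ?m2"
  have N: "0 \<le> ?N" by simp
  have d1: "0 \<le> d\<^sub>1"
  proof (rule ccontr)
    assume "\<not> 0 \<le> d\<^sub>1"
    then have neg: "d\<^sub>1 < 0" "d\<^sub>2 < 0" "0 < - d\<^sub>3" using ord by auto
    then have le: "0 \<le> - d\<^sub>3 * W" "d\<^sub>1 * (cmod c\<^sub>1)\<^sup>2 \<le> 0" "d\<^sub>2 * (cmod c\<^sub>2)\<^sup>2 \<le> 0"
      using W by (auto simp: mult_nonpos_nonneg)
    then have "- d\<^sub>3 * W = 0" "d\<^sub>1 * (cmod c\<^sub>1)\<^sup>2 = 0" "d\<^sub>2 * (cmod c\<^sub>2)\<^sup>2 = 0"
      using energy by linarith+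
    then show False using neg nz by auto
  qed
  have \<mu>: "0 \<le> \<mu>" unfolding \<mu>_def
  proof (rule herm2_max_nonneg)
    show "(0 \<le> ?m1 \<and> 0 \<le> ?m3) \<or> ?m1 * ?m3 \<le> (cmod ?m2)\<^sup>2"
    proof (cases "0 \<le> d\<^sub>2")
      case True
      then show ?thesis using d1 by simp
    next
      case False
      then have "d\<^sub>1 * d\<^sub>2 * ?N \<le> 0" using d1 by (simp add: mult_nonneg_nonpos mult_nonpos_nonneg)
      moreover have "(cmod ?m2)\<^sup>2 = (cmod g)\<^sup>2 * (d\<^sub>1 * x\<^sub>2 + d\<^sub>2 * x\<^sub>1)\<^sup>2"
        by (simp only: norm_mult norm_of_real power_mult_distrib) simp
      ultimately show ?thesis
        using adjugate_form_det[of d\<^sub>1 d\<^sub>2 x\<^sub>2 "(cmod g)\<^sup>2" x\<^sub>1] by linarith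
    qed
  qed
  have bound: "?N * (- d\<^sub>3 * W) \<le> \<mu> * K * W"
  proof -
    have "?N * (- d\<^sub>3 * W) \<le> ?N * (d\<^sub>1 * (cmod c\<^sub>1)\<^sup>2 + d\<^sub>2 * (cmod c\<^sub>2)\<^sup>2)"
      using energy N by (rule mult_left_mono)
    also have "\<dots> = ?m1 * (cmod y\<^sub>1)\<^sup>2 + ?m3 * (cmod y\<^sub>2)\<^sup>2 + 2 * Re (?m2 * y\<^sub>1 * cnj y\<^sub>2)"
      by (rule adjugate_form_identity[OF y])
    also have "\<dots> \<le> \<mu> * ((cmod y\<^sub>1)\<^sup>2 + (cmod y\<^sub>2)\<^sup>2)"
      unfolding \<mu>_def by (rule herm2_form_le)
    also have "\<dots> \<le> \<mu> * (K * W)" using coupling \<mu> by (rule mult_left_mono)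
    finally show ?thesis by simp
  qed
  have "?N * (- d\<^sub>3) \<le> \<mu> * K"
  \<comment> \<open>If \<open>W = 0\<close>, the homogeneous system has a nonzero solution and the determinant vanishes.\<close>
  proof (cases "W = 0")
    case True
    then have "y\<^sub>1 = 0" "y\<^sub>2 = 0"
      using coupling by (simp_all add: sum_power2_le_zero_iff)
    with adjugate_solution[OF y]
    have "Complex d\<^sub>1 x\<^sub>1 * Complex d\<^sub>2 x\<^sub>2 + g * cnj g = 0" using nz True by auto
    then have "?N = 0" unfolding cmod_det_squared[symmetric] by simp
    then show ?thesis using \<mu> K by simp
  next
    case False
    then have "0 < W" using W by simp
    moreover have "?N * (- d\<^sub>3) * W \<le> \<mu> * K * W" using bound by simp
    ultimately show ?thesis by (rule mult_right_le_imp_le[rotated])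
  qed
  then show ?thesis unfolding \<mu>_def by (simp add: mult.commute)
qed

section \<open>Hermitian and skew-Hermitian parts\<close>

lemma hermitian_part_adjoint:
  assumes "A \<in> carrier_mat n n"
  shows "hermitian_part A \<in> carrier_mat n n" "mat_adjoint (hermitian_part A) = hermitian_part A"
proof -
  show "hermitian_part A \<in> carrier_mat n n" using assms unfolding hermitian_part_def by auto
  show "mat_adjoint (hermitian_part A) = hermitian_part A"
    by (rule eq_matI) (use assms in \<open>auto simp: hermitian_part_def mat_adjoint_index algebra_simps\<close>)
qed

lemma skew_hermitian_part_adjoint:
  assumes "A \<in> carrier_mat n n"
  shows "skew_hermitian_part A \<in> carrier_mat n n"
    "mat_adjoint (skew_hermitian_part A) = - skew_hermitian_part A"
proof -
  show "skew_hermitian_part A \<in> carrier_mat n n" using assms unfolding skew_hermitian_part_def by auto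
  show "mat_adjoint (skew_hermitian_part A) = - skew_hermitian_part A"
    by (rule eq_matI) (use assms in \<open>auto simp: skew_hermitian_part_def mat_adjoint_index algebra_simps\<close>)
qed

lemma hermitian_plus_skew_hermitian:
  assumes "A \<in> carrier_mat n n"
  shows "hermitian_part A + skew_hermitian_part A = A"
  by (rule eq_matI) (use assms in \<open>auto simp: hermitian_part_def skew_hermitian_part_def field_simps\<close>)

section \<open>The eigenvalue inequality\<close>

theorem proposition3:
  fixes n :: nat and A H S :: "complex mat" and u\<^sub>1 u\<^sub>2 :: "complex vec"
    and ds :: "real list" and s t \<delta>\<^sub>1 \<delta>\<^sub>2 \<delta>\<^sub>3 \<alpha> \<beta> K\<^sub>2 m\<^sub>1 m\<^sub>3 :: real and \<gamma> m\<^sub>2 :: complex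
  assumes n: "n \<ge> 3"
    and A: "A \<in> carrier_mat n n"
    and H: "H = hermitian_part A"
    and S: "S = skew_hermitian_part A"
    and eigenvalue: "eigenvalue A (Complex s t)"
    and ds: "decreasing_eigenvalues H ds"
    and \<delta>: "\<delta>\<^sub>1 = ds ! 0" "\<delta>\<^sub>2 = ds ! 1" "\<delta>\<^sub>3 = ds ! 2"
    and eigenvectors: "eigenvector H u\<^sub>1 (complex_of_real \<delta>\<^sub>1)"
      "eigenvector H u\<^sub>2 (complex_of_real \<delta>\<^sub>2)"
    and orthonormal: "vec_norm2 u\<^sub>1 = 1" "vec_norm2 u\<^sub>2 = 1" "u\<^sub>2 \<bullet>c u\<^sub>1 = 0"
    and \<alpha>: "complex_of_real \<alpha> = - \<i> * ((S *\<^sub>v u\<^sub>1) \<bullet>c u\<^sub>1)"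
    and \<beta>: "complex_of_real \<beta> = - \<i> * ((S *\<^sub>v u\<^sub>2) \<bullet>c u\<^sub>2)"
    and \<gamma>: "\<gamma> = (S *\<^sub>v u\<^sub>1) \<bullet>c u\<^sub>2"
    and K\<^sub>2: "K\<^sub>2 = 1/2 * ((vec_norm2 (S *\<^sub>v u\<^sub>1))\<^sup>2 + (vec_norm2 (S *\<^sub>v u\<^sub>2))\<^sup>2
        - \<alpha>\<^sup>2 - \<beta>\<^sup>2 - 2 * (cmod \<gamma>)\<^sup>2
        + sqrt (((vec_norm2 (S *\<^sub>v u\<^sub>1))\<^sup>2 - (vec_norm2 (S *\<^sub>v u\<^sub>2))\<^sup>2 - \<alpha>\<^sup>2 + \<beta>\<^sup>2)\<^sup>2
            + 4 * (cmod ((S *\<^sub>v u\<^sub>1) \<bullet>c (S *\<^sub>v u\<^sub>2)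
                + \<i> * \<gamma> * complex_of_real (\<alpha> + \<beta>)))\<^sup>2))"
    and m\<^sub>1: "m\<^sub>1 = (\<delta>\<^sub>1 - s) * ((\<delta>\<^sub>2 - s)\<^sup>2 + (\<beta> - t)\<^sup>2) + (\<delta>\<^sub>2 - s) * (cmod \<gamma>)\<^sup>2"
    and m\<^sub>2: "m\<^sub>2 = \<i> * \<gamma> * complex_of_real ((\<delta>\<^sub>1 - s) * (\<beta> - t) + (\<delta>\<^sub>2 - s) * (\<alpha> - t))"
    and m\<^sub>3: "m\<^sub>3 = (\<delta>\<^sub>2 - s) * ((\<delta>\<^sub>1 - s)\<^sup>2 + (\<alpha> - t)\<^sup>2) + (\<delta>\<^sub>1 - s) * (cmod \<gamma>)\<^sup>2"
  shows "(((\<delta>\<^sub>1 - s) * (\<delta>\<^sub>2 - s) - (\<alpha> - t) * (\<beta> - t) + (cmod \<gamma>)\<^sup>2)\<^sup>2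
          + ((\<delta>\<^sub>1 - s) * (\<beta> - t) + (\<delta>\<^sub>2 - s) * (\<alpha> - t))\<^sup>2) * (s - \<delta>\<^sub>3)
      \<le> K\<^sub>2 / 2 * (m\<^sub>1 + m\<^sub>3 + sqrt ((m\<^sub>1 - m\<^sub>3)\<^sup>2 + 4 * (cmod m\<^sub>2)\<^sup>2))"
proof -
  have Hc: "H \<in> carrier_mat n n" and H_adj: "mat_adjoint H = H"
    unfolding H using hermitian_part_adjoint[OF A] by auto
  have Sc: "S \<in> carrier_mat n n" and S_adj: "mat_adjoint S = - S"
    unfolding S using skew_hermitian_part_adjoint[OF A] by auto
  have HS: "H + S = A" unfolding H S by (rule hermitian_plus_skew_hermitian[OF A])
  have u: "u\<^sub>1 \<in> carrier_vec n" "u\<^sub>2 \<in> carrier_vec n"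
    and Hu: "H *\<^sub>v u\<^sub>1 = complex_of_real \<delta>\<^sub>1 \<cdot>\<^sub>v u\<^sub>1" "H *\<^sub>v u\<^sub>2 = complex_of_real \<delta>\<^sub>2 \<cdot>\<^sub>v u\<^sub>2"
    using eigenvectors Hc unfolding eigenvector_def by auto
  define ev where "ev = Complex s t"
  obtain x where "eigenvector A x ev" using eigenvalue unfolding eigenvalue_def ev_def by blast
  then have x: "x \<in> carrier_vec n" "x \<noteq> 0\<^sub>v n" and Ax: "A *\<^sub>v x = ev \<cdot>\<^sub>v x"
    using A unfolding eigenvector_def by auto
  have Su: "S *\<^sub>v u\<^sub>1 \<in> carrier_vec n" "S *\<^sub>v u\<^sub>2 \<in> carrier_vec n"
    using Sc u by auto
  define c\<^sub>1 c\<^sub>2 where "c\<^sub>1 = x \<bullet>c u\<^sub>1" and "c\<^sub>2 = x \<bullet>c u\<^sub>2"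
  define v where "v = c\<^sub>1 \<cdot>\<^sub>v u\<^sub>1 + c\<^sub>2 \<cdot>\<^sub>v u\<^sub>2"
  define w where "w = x - v"
  have v: "v \<in> carrier_vec n" unfolding v_def using u by simp
  have w: "w \<in> carrier_vec n" unfolding w_def using x v by simp
  have x_split: "x = v + w" unfolding w_def using x v by auto
  note dims [simp] = carrier_vecD[OF u(1)] carrier_vecD[OF u(2)] carrier_vecD[OF x(1)]
    carrier_vecD[OF v] carrier_vecD[OF w] carrier_matD[OF Sc] carrier_matD[OF Hc] carrier_matD[OF A]
  have uu: "u\<^sub>1 \<bullet>c u\<^sub>1 = 1" "u\<^sub>2 \<bullet>c u\<^sub>2 = 1" "u\<^sub>2 \<bullet>c u\<^sub>1 = 0" "u\<^sub>1 \<bullet>c u\<^sub>2 = 0"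
    using orthonormal cscalar_cnj[of u\<^sub>2 u\<^sub>1] by (auto simp: cscalar_self)
  have wu: "w \<bullet>c u\<^sub>1 = 0" "w \<bullet>c u\<^sub>2 = 0"
    by (simp_all add: w_def v_def cscalar_sesquilinear uu c\<^sub>1_def c\<^sub>2_def)
  have uw: "u\<^sub>1 \<bullet>c w = 0" "u\<^sub>2 \<bullet>c w = 0"
    using cscalar_cnj[of w u\<^sub>1] cscalar_cnj[of w u\<^sub>2] wu by auto
  have H_move: "(H *\<^sub>v a) \<bullet>c b = a \<bullet>c (H *\<^sub>v b)" if "a \<in> carrier_vec n" "b \<in> carrier_vec n" for a b
    using cscalar_adjoint[OF Hc that] H_adj by simp
  have S_move: "(S *\<^sub>v a) \<bullet>c b = - (a \<bullet>c (S *\<^sub>v b))" if "a \<in> carrier_vec n" "b \<in> carrier_vec n" for a b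
  proof -
    have "- S *\<^sub>v b = (- 1) \<cdot>\<^sub>v (S *\<^sub>v b)" using Sc that by (intro eq_vecI) (auto simp: scalar_prod_def sum_negf)
    then show ?thesis using cscalar_adjoint[OF Sc that] S_adj that by (simp add: cscalar_smult_right)
  qed
  have Ax_split: "A *\<^sub>v x = H *\<^sub>v x + S *\<^sub>v x"
    unfolding HS[symmetric] using Hc Sc x by (simp add: add_mult_distrib_mat_vec)

  have S11: "(S *\<^sub>v u\<^sub>1) \<bullet>c u\<^sub>1 = \<i> * \<alpha>" and S22: "(S *\<^sub>v u\<^sub>2) \<bullet>c u\<^sub>2 = \<i> * \<beta>"
    using \<alpha> \<beta> by (simp_all add: field_simps)
  have S12: "(S *\<^sub>v u\<^sub>1) \<bullet>c u\<^sub>2 = \<gamma>" using \<gamma> by simp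
  have uS: "u\<^sub>1 \<bullet>c (S *\<^sub>v u\<^sub>1) = - \<i> * \<alpha>" "u\<^sub>2 \<bullet>c (S *\<^sub>v u\<^sub>2) = - \<i> * \<beta>" "u\<^sub>2 \<bullet>c (S *\<^sub>v u\<^sub>1) = cnj \<gamma>"
    using cscalar_cnj[of "S *\<^sub>v u\<^sub>1" u\<^sub>1] cscalar_cnj[of "S *\<^sub>v u\<^sub>2" u\<^sub>2] cscalar_cnj[of "S *\<^sub>v u\<^sub>1" u\<^sub>2] S11 S22 S12
    by auto
  have S21: "(S *\<^sub>v u\<^sub>2) \<bullet>c u\<^sub>1 = - cnj \<gamma>" using S_move[OF u(2,1)] uS by simp
  have uS': "u\<^sub>1 \<bullet>c (S *\<^sub>v u\<^sub>2) = - \<gamma>"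
    using cscalar_cnj[of "S *\<^sub>v u\<^sub>2" u\<^sub>1] S21 by auto

  \<comment> \<open>The components of the eigenvalue equation along \<open>u\<^sub>1\<close> and \<open>u\<^sub>2\<close>. Moving \<open>H\<close> and \<open>S\<close> to the other
    side of the inner product leaves only known entries and the coupling \<open>y\<close> to \<open>w\<close>.\<close>
  define y\<^sub>1 y\<^sub>2 where "y\<^sub>1 = w \<bullet>c (S *\<^sub>v u\<^sub>1)" and "y\<^sub>2 = w \<bullet>c (S *\<^sub>v u\<^sub>2)"
  have y1: "y\<^sub>1 = Complex (\<delta>\<^sub>1 - s) (\<alpha> - t) * c\<^sub>1 - cnj \<gamma> * c\<^sub>2"
  proof -
    have "ev * c\<^sub>1 = (A *\<^sub>v x) \<bullet>c u\<^sub>1" unfolding Ax by (simp add: cscalar_smult_left c\<^sub>1_def)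
    also have "\<dots> = x \<bullet>c (H *\<^sub>v u\<^sub>1) - x \<bullet>c (S *\<^sub>v u\<^sub>1)"
      unfolding Ax_split by (simp add: cscalar_add_left H_move S_move x u)
    also have "x \<bullet>c (S *\<^sub>v u\<^sub>1) = - \<i> * \<alpha> * c\<^sub>1 + cnj \<gamma> * c\<^sub>2 + y\<^sub>1"
      by (subst x_split) (simp add: v_def cscalar_sesquilinear uS y\<^sub>1_def algebra_simps)
    finally show ?thesis
      by (simp add: Hu cscalar_smult_right ev_def c\<^sub>1_def[symmetric] Complex_eq algebra_simps)
  qed
  have y2: "y\<^sub>2 = \<gamma> * c\<^sub>1 + Complex (\<delta>\<^sub>2 - s) (\<beta> - t) * c\<^sub>2"
  proof -
    have "ev * c\<^sub>2 = (A *\<^sub>v x) \<bullet>c u\<^sub>2" unfolding Ax by (simp add: cscalar_smult_left c\<^sub>2_def)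
    also have "\<dots> = x \<bullet>c (H *\<^sub>v u\<^sub>2) - x \<bullet>c (S *\<^sub>v u\<^sub>2)"
      unfolding Ax_split by (simp add: cscalar_add_left H_move S_move x u)
    also have "x \<bullet>c (S *\<^sub>v u\<^sub>2) = - \<gamma> * c\<^sub>1 - \<i> * \<beta> * c\<^sub>2 + y\<^sub>2"
      by (subst x_split) (simp add: v_def cscalar_sesquilinear uS uS' y\<^sub>2_def algebra_simps)
    finally show ?thesis
      by (simp add: Hu cscalar_smult_right ev_def c\<^sub>2_def[symmetric] Complex_eq algebra_simps)
  qed

  \<comment> \<open>The real part of \<open>x\<^sup>* A x\<close>; the skew-Hermitian part contributes nothing to it.\<close>
  have energy: "- (\<delta>\<^sub>3 - s) * (vec_norm2 w)\<^sup>2 \<le> (\<delta>\<^sub>1 - s) * (cmod c\<^sub>1)\<^sup>2 + (\<delta>\<^sub>2 - s) * (cmod c\<^sub>2)\<^sup>2"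
  proof -
    have "(S *\<^sub>v x) \<bullet>c x = - (x \<bullet>c (S *\<^sub>v x))"
      by (rule S_move[OF x(1) x(1)])
    also have "x \<bullet>c (S *\<^sub>v x) = cnj ((S *\<^sub>v x) \<bullet>c x)"
      by (rule cscalar_cnj[symmetric]) simp
    finally have "(S *\<^sub>v x) \<bullet>c x = - cnj ((S *\<^sub>v x) \<bullet>c x)" .
    from arg_cong[OF this, of Re] have "Re ((S *\<^sub>v x) \<bullet>c x) = 0" by simp
    moreover have "Re ((A *\<^sub>v x) \<bullet>c x) = s * Re (x \<bullet>c x)"
      unfolding Ax by (simp add: cscalar_smult_left cscalar_self ev_def del: of_real_power)
    ultimately have "s * Re (x \<bullet>c x) = Re ((H *\<^sub>v x) \<bullet>c x)"
      unfolding Ax_split by (simp add: cscalar_add_left)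
    also have "H *\<^sub>v x = (c\<^sub>1 * \<delta>\<^sub>1) \<cdot>\<^sub>v u\<^sub>1 + (c\<^sub>2 * \<delta>\<^sub>2) \<cdot>\<^sub>v u\<^sub>2 + H *\<^sub>v w"
      by (subst x_split) (use Hc u w in \<open>simp add: v_def mult_add_distrib_mat_vec mult_mat_vec Hu smult_smult_assoc\<close>)
    also have "\<dots> \<bullet>c x = \<delta>\<^sub>1 * (c\<^sub>1 * cnj c\<^sub>1) + \<delta>\<^sub>2 * (c\<^sub>2 * cnj c\<^sub>2) + (H *\<^sub>v w) \<bullet>c w"
      by (subst x_split) (simp add: v_def cscalar_sesquilinear uu uw H_move u w Hu wu)
    finally have "s * Re (x \<bullet>c x) = \<delta>\<^sub>1 * (cmod c\<^sub>1)\<^sup>2 + \<delta>\<^sub>2 * (cmod c\<^sub>2)\<^sup>2 + Re ((H *\<^sub>v w) \<bullet>c w)"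
      by (simp add: complex_norm_square[symmetric] del: of_real_power)
    moreover have "x \<bullet>c x = complex_of_real ((cmod c\<^sub>1)\<^sup>2 + (cmod c\<^sub>2)\<^sup>2 + (vec_norm2 w)\<^sup>2)"
      by (subst (1 2) x_split)
        (simp add: v_def cscalar_sesquilinear uu uw wu cscalar_self[of w] complex_norm_square del: of_real_power)
    moreover have "Re ((H *\<^sub>v w) \<bullet>c w) \<le> \<delta>\<^sub>3 * (vec_norm2 w)\<^sup>2"
      unfolding \<delta> by (rule rayleigh_third_eigenvalue[OF Hc H_adj ds n u orthonormal Hu[unfolded \<delta>] w wu])
    ultimately show ?thesis by (simp add: algebra_simps)
  qed

  \<comment> \<open>The parts of \<open>S u\<^sub>1\<close> and \<open>S u\<^sub>2\<close> orthogonal to \<open>u\<^sub>1\<close> and \<open>u\<^sub>2\<close>. Their Gram matrix has \<open>K\<^sub>2\<close> as its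
    largest eigenvalue, and replacing \<open>S u\<^sub>k\<close> by \<open>p\<^sub>k\<close> does not change its product with \<open>w\<close>.\<close>
  define p\<^sub>1 p\<^sub>2 where "p\<^sub>1 = S *\<^sub>v u\<^sub>1 - ((\<i> * \<alpha>) \<cdot>\<^sub>v u\<^sub>1 + \<gamma> \<cdot>\<^sub>v u\<^sub>2)"
    and "p\<^sub>2 = S *\<^sub>v u\<^sub>2 - ((\<i> * \<beta>) \<cdot>\<^sub>v u\<^sub>2 - cnj \<gamma> \<cdot>\<^sub>v u\<^sub>1)"
  have p: "p\<^sub>1 \<in> carrier_vec n" "p\<^sub>2 \<in> carrier_vec n"
    unfolding p\<^sub>1_def p\<^sub>2_def using Su u by auto
  have wp: "w \<bullet>c p\<^sub>1 = y\<^sub>1" "w \<bullet>c p\<^sub>2 = y\<^sub>2"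
    by (simp_all add: p\<^sub>1_def p\<^sub>2_def cscalar_sesquilinear wu y\<^sub>1_def y\<^sub>2_def)
  have p11: "(vec_norm2 p\<^sub>1)\<^sup>2 = (vec_norm2 (S *\<^sub>v u\<^sub>1))\<^sup>2 - \<alpha>\<^sup>2 - (cmod \<gamma>)\<^sup>2"
  proof -
    have "p\<^sub>1 \<bullet>c p\<^sub>1 = (S *\<^sub>v u\<^sub>1) \<bullet>c (S *\<^sub>v u\<^sub>1) - \<alpha> * \<alpha> - \<gamma> * cnj \<gamma>"
      by (simp add: p\<^sub>1_def cscalar_sesquilinear uu S11 S12 uS algebra_simps)
    also have "\<dots> = complex_of_real ((vec_norm2 (S *\<^sub>v u\<^sub>1))\<^sup>2 - \<alpha>\<^sup>2 - (cmod \<gamma>)\<^sup>2)"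
      by (simp only: cscalar_self complex_norm_square[symmetric]) (simp add: power2_eq_square)
    finally show ?thesis unfolding cscalar_self of_real_eq_iff .
  qed
  have p22: "(vec_norm2 p\<^sub>2)\<^sup>2 = (vec_norm2 (S *\<^sub>v u\<^sub>2))\<^sup>2 - \<beta>\<^sup>2 - (cmod \<gamma>)\<^sup>2"
  proof -
    have "p\<^sub>2 \<bullet>c p\<^sub>2 = (S *\<^sub>v u\<^sub>2) \<bullet>c (S *\<^sub>v u\<^sub>2) - \<beta> * \<beta> - \<gamma> * cnj \<gamma>"
      by (simp add: p\<^sub>2_def cscalar_sesquilinear uu S22 S21 uS uS' algebra_simps)
    also have "\<dots> = complex_of_real ((vec_norm2 (S *\<^sub>v u\<^sub>2))\<^sup>2 - \<beta>\<^sup>2 - (cmod \<gamma>)\<^sup>2)"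
      by (simp only: cscalar_self complex_norm_square[symmetric]) (simp add: power2_eq_square)
    finally show ?thesis unfolding cscalar_self of_real_eq_iff .
  qed
  have p12: "p\<^sub>1 \<bullet>c p\<^sub>2 = (S *\<^sub>v u\<^sub>1) \<bullet>c (S *\<^sub>v u\<^sub>2) + \<i> * \<gamma> * complex_of_real (\<alpha> + \<beta>)"
    by (simp add: p\<^sub>1_def p\<^sub>2_def cscalar_sesquilinear uu S11 S12 S22 S21 uS uS' algebra_simps)
  have K: "K\<^sub>2 = herm2_max ((vec_norm2 p\<^sub>1)\<^sup>2) ((vec_norm2 p\<^sub>2)\<^sup>2) (p\<^sub>1 \<bullet>c p\<^sub>2)"
    unfolding K\<^sub>2 herm2_max_def p11 p22 p12 by (simp add: algebra_simps)
  have coupling: "(cmod y\<^sub>1)\<^sup>2 + (cmod y\<^sub>2)\<^sup>2 \<le> K\<^sub>2 * (vec_norm2 w)\<^sup>2"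
    using gram_bound[OF p w] unfolding wp K .
  have K0: "0 \<le> K\<^sub>2" unfolding K by (rule herm2_max_nonneg) auto

  have "length ds = n" using decreasing_eigenvalues_char_poly[OF Hc ds] by simp
  then have ord: "\<delta>\<^sub>3 - s \<le> \<delta>\<^sub>2 - s" "\<delta>\<^sub>2 - s \<le> \<delta>\<^sub>1 - s"
    using ds n unfolding decreasing_eigenvalues_def \<delta> by (auto simp: sorted_wrt_iff_nth_less)
  have nz: "c\<^sub>1 \<noteq> 0 \<or> c\<^sub>2 \<noteq> 0 \<or> 0 < (vec_norm2 w)\<^sup>2"
  proof (rule ccontr)
    assume "\<not> ?thesis"
    then have "c\<^sub>1 = 0" "c\<^sub>2 = 0" "w = 0\<^sub>v n"
      using vec_norm2_eq_0_iff[OF w] by auto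
    then have "x = 0\<^sub>v n" using x_split u by (auto simp: v_def)
    then show False using x by simp
  qed
  from determinant_gap_inequality[OF y1 y2 energy coupling ord K0 _ nz]
  show ?thesis unfolding m\<^sub>1 m\<^sub>2 m\<^sub>3 herm2_max_def by simp
qed

end
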